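(* Let $\ell\ge 2$ be an integer and let $m\ge 0$ be an integer with $m<2^{\ell-1}$. Define real numbers $\alpha_j^{(p)},\overline\alpha_j^{(p)}$ for $p\ge1$ and $0\le j\le 2^p-1$ recursively as follows. For $p=1$, $$\overline\alpha_0^{(1)}=\widehat\psi\left(\tfrac{m}{2^\ell}-2\right),\quad \alpha_0^{(1)}=\widehat\psi\left(\tfrac{m}{2^\ell}\right)-1,\quad \overline\alpha_1^{(1)}=\widehat\psi\left(\tfrac{m}{2^\ell}-1\right),\quad \alpha_1^{(1)}=\widehat\psi\left(\tfrac{m}{2^\ell}+1\right),$$ and for $p\ge1$ and $j=0,1,\ldots,2^p-1$, $$\overline\alpha_j^{(p+1)}=\left(\overline\alpha_j^{(p)}+\alpha_j^{(p)}\right)\widehat\psi\left(2-\tfrac{m}{2^{\ell+p}}-\tfrac{j}{2^p}\right),$$ $$\overline\alpha_{2^p+j}^{(p+1)}=\overline\alpha_j^{(p)}\left[\widehat\psi\left(1-\tfrac{m}{2^{\ell+p}}-\tfrac{j}{2^p}\right)-1\right]+\alpha_j^{(p)}\,\widehat\psi\left(1-\tfrac{m}{2^{\ell+p}}-\tfrac{j}{2^p}\right),$$ $$\alpha_j^{(p+1)}=\alpha_j^{(p)}\left[\widehat\psi\left(\tfrac{m}{2^{\ell+p}}+\tfrac{j}{2^p}\right)-1\right]+\overline\alpha_j^{(p)}\,\widehat\psi\left(\tfrac{m}{2^{\ell+p}}+\tfrac{j}{2^p}\right),$$ $$\alpha_{2^p+j}^{(p+1)}=\left(\overline\alpha_j^{(p)}+\alpha_j^{(p)}\right)\widehat\psi\left(1+\tfrac{m}{2^{\ell+p}}+\tfrac{j}{2^p}\right).$$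 Then for every integer $p\ge1$, $$M_{\frac{1}{2^\ell},p}\,c_m=T_{\frac{1}{2^\ell},p}\,c_m+g_p,\qquad\text{where}\qquad T_{\frac{1}{2^\ell},p}\,c_m=\sum_{j=0}^{2^p-1}\left(\overline\alpha_j^{(p)}c_{m-2^\ell(2^p-j)}+\alpha_j^{(p)}c_{m+2^\ell j}\right),$$ and the remainder function $g_p$ satisfies $\|g_p\|_\infty\le pA^{p-1}\epsilon$.
   Context: Let $\psi(x)=\frac{1}{\sqrt{2\pi}}e^{-x^2/2}$ and $\widehat\psi(t)=e^{-2\pi^2t^2}$ its Fourier transform. Constants: $A=2+3\widehat\psi(1)$ and $\epsilon=3\widehat\psi(2)=3e^{-8\pi^2}$. For an integer $m$ (possibly negative), $c_m(x)=\cos(2\pi mx)$, $x\in\mathbb R$. $\|f\|_\infty=\sup_{x\in\mathbb R}|f(x)|$. For a positive integer $n$ and a $1$-periodic continuous function $f$ on $\mathbb R$, the quasi-interpolant is $Q_{\frac1n}(f)(x)=\sum_{\ell\in\mathbb Z}f\left(\frac{\ell}{n}\right)\psi(nx-\ell)$, and the error operator is $E_{\frac1n}(f)=Q_{\frac1n}(f)-f$. The multilevel error operators are defined recursively by $M_{\frac1n,0}=I$ (the identity) and $M_{\frac1n,p}(f)=E_{\frac{1}{2^{p-1}n}}\bigl(M_{\frac1n,p-1}(f)\bigr)$ for $p\ge1$. *)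

theory Defs
  imports "HOL-Probability.Probability"
begin

definition psi :: "real \<Rightarrow> real" where
  "psi x = 1 / sqrt (2 * pi) * exp (- x\<^sup>2 / 2)"

definition psi_hat :: "real \<Rightarrow> real" where
  "psi_hat t = exp (- 2 * pi\<^sup>2 * t\<^sup>2)"

lemma psi_eq_std_normal_density: "psi = std_normal_density"
  by (simp add: fun_eq_iff psi_def std_normal_density_def)

lemma fourier_transform_psi:
  "(LINT x|lborel. complex_of_real (psi x) * cis (- 2 * pi * t * x)) = complex_of_real (psi_hat t)"
proof -
  have "complex_of_real (psi_hat t) = char std_normal_distribution (- 2 * pi * t)"
    by (simp add: char_std_normal_distribution psi_hat_def power_mult_distrib)
  also have "\<dots> = (LINT x|lborel. psi x *\<^sub>R cis (- 2 * pi * t * x))"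
    unfolding char_def psi_eq_std_normal_density
    by (subst integral_density) (auto simp: cis_conv_exp mult_ac)
  finally show ?thesis by (simp add: scaleR_conv_of_real)
qed

definition const_A :: real where
  "const_A = 2 + 3 * psi_hat 1"

definition const_eps :: real where
  "const_eps = 3 * psi_hat 2"

definition cos_mode :: "int \<Rightarrow> real \<Rightarrow> real" where
  "cos_mode k x = cos (2 * pi * of_int k * x)"

text \<open>The supremum is taken in the extended reals, so that it is \<open>\<infinity>\<close> for unbounded functions.\<close>

definition sup_norm :: "(real \<Rightarrow> real) \<Rightarrow> ereal" where
  "sup_norm f = (SUP x. ereal \<bar>f x\<bar>)"

text \<open>
  The operators with step size \<open>1/n\<close> are indexed by \<open>n\<close>. They are meant for \<open>n > 0\<close> and
  continuous \<open>1\<close>-periodic \<open>f\<close>; such an \<open>f\<close> is bounded, so the series converges absolutely.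
\<close>

definition quasi_interp :: "nat \<Rightarrow> (real \<Rightarrow> real) \<Rightarrow> real \<Rightarrow> real" where
  "quasi_interp n f x = (\<Sum>\<^sub>\<infinity>k\<in>(UNIV :: int set). f (of_int k / real n) * psi (real n * x - of_int k))"

definition error_op :: "nat \<Rightarrow> (real \<Rightarrow> real) \<Rightarrow> real \<Rightarrow> real" where
  "error_op n f x = quasi_interp n f x - f x"

primrec multilevel_error :: "nat \<Rightarrow> nat \<Rightarrow> (real \<Rightarrow> real) \<Rightarrow> real \<Rightarrow> real" where
  "multilevel_error n 0 f = f"
| "multilevel_error n (Suc p) f = error_op (2 ^ p * n) (multilevel_error n p f)"

end

(*
The interpolant of a cosine only sees its samples, and Poisson summation turns the sampled
series into sum_k psi_hat(t + k) c_(a + k n) with t = a / n.  At level p + 1 the grid size is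
n = 2^(l + p), and the modes c_(m - 2^l (2^p - j)) and c_(m + 2^l j) are aliases of each other;
keeping the four terms k = -2, -1, 0, 1 gives exactly the recursion for the coefficients, while
the discarded tail is at most 3 psi_hat(2).  Since sum_k psi_hat(t + k) is itself at most
1 + 3 psi_hat(1) (Poisson summation once more), each step multiplies both the sup norm of the
remainder and the l^1 norm of the coefficients by at most A, which gives the bound p A^(p-1) eps
by induction.  The induction starts at p = 0 with the single coefficient alpha_0 = 1.
Poisson summation is derived from Fejer's theorem applied to the periodization.
*)
theory Submission imports Defs begin

section \<open>Fejer kernel and Fejer's theorem at the origin\<close>

(* n times the Fejer kernel, normalized to period 1. *)
definition fejer_sum :: "nat \<Rightarrow> real \<Rightarrow> real" where
  "fejer_sum n u = (\<Sum>N<n. \<Sum>k = - int N..int N. cos (2 * pi * of_int k * u))"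

lemma sum_symmetric_int_Suc:
  fixes f :: "int \<Rightarrow> 'a :: comm_monoid_add"
  shows "(\<Sum>k = - int (Suc n)..int (Suc n). f k)
    = (\<Sum>k = - int n..int n. f k) + f (int (Suc n)) + f (- int (Suc n))"
proof -
  have "{- int (Suc n)..int (Suc n)} = insert (int (Suc n)) (insert (- int (Suc n)) {- int n..int n})"
    by auto
  then show ?thesis by (simp add: add_ac)
qed

text \<open>The frequencies are listed as \<open>n - j\<close> so that the addition formula for
  cosine turns them into the cross terms needed for the square identity below.\<close>

lemma dirichlet_sum_eq:
  "(\<Sum>k = - int n..int n. cos (2 * pi * of_int k * u)) = 1 + 2 * (\<Sum>j<n. cos (2 * pi * (real n - real j) * u))"
proof -
  have "(\<Sum>k = - int n..int n. cos (2 * pi * of_int k * u)) = 1 + 2 * (\<Sum>j<n. cos (2 * pi * real (Suc j) * u))"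
  proof (induction n)
    case (Suc n)
    have "cos (2 * pi * of_int (- int (Suc n)) * u) = cos (2 * pi * of_int (int (Suc n)) * u)"
      by (metis cos_minus mult_minus_left mult_minus_right of_int_minus)
    then show ?case
      unfolding sum_symmetric_int_Suc Suc.IH by simp
  qed simp
  also have "(\<Sum>j<n. cos (2 * pi * real (Suc j) * u)) = (\<Sum>j<n. cos (2 * pi * (real n - real j) * u))"
    by (subst sum.nat_diff_reindex[symmetric]) (intro sum.cong, auto simp: of_nat_diff algebra_simps)
  finally show ?thesis .
qed

text \<open>Both sides are |sum_(j<n) e^(2 pi i j u)|^2. Adding the term with index n contributes
  its squared modulus 1 and twice the cross terms cos (2 pi (n - j) u), together the Dirichlet sum
  of order n. Nonnegativity of the kernel follows.\<close>

lemma fejer_sum_eq_squares: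
  "fejer_sum n u = (\<Sum>j<n. cos (2 * pi * real j * u))\<^sup>2 + (\<Sum>j<n. sin (2 * pi * real j * u))\<^sup>2"
proof (induction n)
  case 0
  show ?case by (simp add: fejer_sum_def)
next
  case (Suc n)
  let ?c = "\<lambda>j. cos (2 * pi * real j * u)" and ?s = "\<lambda>j. sin (2 * pi * real j * u)"
  have "(\<Sum>j<n. cos (2 * pi * (real n - real j) * u)) = (\<Sum>j<n. ?c n * ?c j + ?s n * ?s j)"
    by (intro sum.cong refl, subst cos_diff[symmetric]) (simp add: algebra_simps)
  also have "\<dots> = ?c n * (\<Sum>j<n. ?c j) + ?s n * (\<Sum>j<n. ?s j)"
    by (simp add: sum.distrib sum_distrib_left)
  finally have "fejer_sum (Suc n) u = fejer_sum n u + (?c n)\<^sup>2 + (?s n)\<^sup>2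
      + 2 * (?c n * (\<Sum>j<n. ?c j) + ?s n * (\<Sum>j<n. ?s j))"
    by (simp add: fejer_sum_def dirichlet_sum_eq)
  then show ?case
    by (simp add: Suc.IH power2_sum algebra_simps)
qed

lemma fejer_sum_nonneg: "fejer_sum n u \<ge> 0"
  by (simp add: fejer_sum_eq_squares)

lemma has_integral_cos_period:
  fixes k :: int
  shows "((\<lambda>u. cos (2 * pi * of_int k * u)) has_integral (if k = 0 then 1 else 0)) {-1/2..1/2}"
proof (cases "k = 0")
  case True
  then show ?thesis using has_integral_const_real[of "1::real" "-1/2" "1/2"] by simp
next
  case False
  have "((\<lambda>u. cos (2 * pi * of_int k * u)) has_integral
      (sin (2 * pi * of_int k * (1/2)) / (2 * pi * of_int k)
        - sin (2 * pi * of_int k * (-1/2)) / (2 * pi * of_int k))) {-1/2..1/2}"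
    using False
    by (intro fundamental_theorem_of_calculus)
      (auto intro!: derivative_eq_intros simp: has_real_derivative_iff_has_vector_derivative[symmetric])
  moreover have "sin (pi * of_int k) = 0"
    using sin_int_times_real by (simp add: sin_zero_iff_int2)
  ultimately show ?thesis using False by (simp add: algebra_simps)
qed

lemma has_integral_fejer_sum: "(fejer_sum n has_integral real n) {-1/2..1/2}"
proof -
  have "(fejer_sum n has_integral (\<Sum>N<n. \<Sum>k = - int N..int N. if k = 0 then 1 else 0)) {-1/2..1/2}"
    unfolding fejer_sum_def[abs_def] by (intro has_integral_sum has_integral_cos_period) auto
  then show ?thesis by (simp add: sum.delta)
qed

text \<open>Since sin^2 (pi u) = (1 - cos (2 pi u)) / 2, multiplying by it mixes each frequency with
  its two neighbours. The Dirichlet sum of order N then integrates to 1/2 - 1/4 - 1/4 = 0 for N > 0,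
  and only N = 0 contributes 1/2.\<close>

lemma has_integral_fejer_sum_sin_squared:
  assumes "n > 0"
  shows "((\<lambda>u. fejer_sum n u * (sin (pi * u))\<^sup>2) has_integral 1/2) {-1/2..1/2}"
proof -
  have eq: "cos (2 * pi * of_int k * u) * (sin (pi * u))\<^sup>2 =
     1/2 * cos (2 * pi * of_int k * u)
     - 1/4 * (cos (2 * pi * of_int (k + 1) * u) + cos (2 * pi * of_int (k - 1) * u))" for k :: int and u :: real
  proof -
    have "(sin (pi * u))\<^sup>2 = (1 - cos (2 * pi * u)) / 2"
      using cos_double_sin[of "pi * u"] by (simp add: algebra_simps)
    moreover have "cos (2 * pi * of_int (k + 1) * u) + cos (2 * pi * of_int (k - 1) * u)
        = 2 * cos (2 * pi * of_int k * u) * cos (2 * pi * u)"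
      by (simp add: algebra_simps cos_add cos_diff)
    ultimately show ?thesis by algebra
  qed
  have "((\<lambda>u. fejer_sum n u * (sin (pi * u))\<^sup>2) has_integral
     (\<Sum>N<n. \<Sum>k = - int N..int N. 1/2 * (if k = 0 then 1 else 0)
       - 1/4 * ((if k + 1 = 0 then 1 else 0) + (if k - 1 = 0 then 1 else 0)))) {-1/2..1/2}"
    unfolding fejer_sum_def sum_distrib_right eq
    by (intro has_integral_sum has_integral_diff has_integral_mult_right has_integral_add
        has_integral_cos_period) auto
  also have "(\<Sum>N<n. \<Sum>k = - int N..int N. 1/2 * (if k = 0 then 1 else 0 :: real)
       - 1/4 * ((if k + 1 = 0 then 1 else 0) + (if k - 1 = 0 then 1 else 0)))
     = (\<Sum>N<n. if N = 0 then 1/2 else 0)"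
  proof (intro sum.cong refl)
    fix N :: nat
    have *: "(\<Sum>k = - int N..int N. if k + 1 = 0 then 1 else 0 :: real) = (if N = 0 then 0 else 1)"
      "(\<Sum>k = - int N..int N. if k - 1 = 0 then 1 else 0 :: real) = (if N = 0 then 0 else 1)"
      using sum.delta[of "{- int N..int N}" "-1" "\<lambda>_. 1::real"] sum.delta[of "{- int N..int N}" 1 "\<lambda>_. 1::real"]
      by (simp_all add: eq_neg_iff_add_eq_0[symmetric])
    show "(\<Sum>k = - int N..int N. 1/2 * (if k = 0 then 1 else 0 :: real)
       - 1/4 * ((if k + 1 = 0 then 1 else 0) + (if k - 1 = 0 then 1 else 0))) = (if N = 0 then 1/2 else 0)"
      unfolding sum_subtractf sum.distrib sum_distrib_left[symmetric] * by simp
  qed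
  also have "\<dots> = 1/2" using assms by simp
  finally show ?thesis .
qed

text \<open>The double sum of Fourier coefficients is the integral of \<open>F\<close> against a
  nonnegative kernel of mass \<open>n\<close>, so it suffices to integrate the deviation
  \<open>F u - F 0\<close>.\<close>

lemma fejer:
  fixes F :: "real \<Rightarrow> real"
  assumes cont: "continuous_on {-1/2..1/2} F"
  shows "(\<lambda>n. (\<Sum>N<n. \<Sum>k = - int N..int N.
      integral {-1/2..1/2} (\<lambda>u. F u * cos (2 * pi * of_int k * u))) / real n) \<longlonglongrightarrow> F 0"
proof -
  let ?I = "{-1/2..1/2::real}"
  define S where "S n = (\<Sum>N<n. \<Sum>k = - int N..int N.
      integral ?I (\<lambda>u. F u * cos (2 * pi * of_int k * u)))" for n
  have S: "((\<lambda>u. F u * fejer_sum n u) has_integral S n) ?I" for n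
    unfolding fejer_sum_def sum_distrib_left S_def
    by (intro has_integral_sum integrable_integral integrable_continuous_real continuous_intros cont) auto
  have "compact (F ` ?I)" by (intro compact_continuous_image cont) auto
  then obtain B where B: "\<And>u. u \<in> ?I \<Longrightarrow> \<bar>F u\<bar> \<le> B"
    using compact_imp_bounded bounded_real by (metis imageI)
  have "(\<lambda>n. S n / real n) \<longlonglongrightarrow> F 0"
  proof (rule LIMSEQ_I)
    fix e :: real assume e: "e > 0"
    obtain d' where d': "d' > 0" "\<And>u. u \<in> ?I \<Longrightarrow> \<bar>u\<bar> < d' \<Longrightarrow> \<bar>F u - F 0\<bar> < e/2"
      using cont[unfolded continuous_on_iff, rule_format, of 0 "e/2"] e
      by (fastforce simp: dist_real_def)
    \<comment> \<open>The cap 1/2 keeps \<open>pi * d\<close> at most pi/2, where sine is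
      increasing.\<close>
    define d where "d = min d' (1/2)"
    have d: "d > 0" "d \<le> 1/2" "\<And>u. u \<in> ?I \<Longrightarrow> \<bar>u\<bar> < d \<Longrightarrow> \<bar>F u - F 0\<bar> < e/2"
      using d' by (auto simp: d_def)
    \<comment> \<open>With this \<open>C\<close> the sine term alone exceeds the crude bound
      \<open>2 * B\<close> as soon as \<bar>u\<bar> \<ge> \<open>d\<close>.\<close>
    define C where "C = 2 * B / (sin (pi * d))\<^sup>2"
    have sd: "sin (pi * d) > 0"
      using d by (intro sin_gt_zero) (auto simp: field_simps intro: order.strict_trans1[of _ "pi * (1/2)"])
    have B0: "B \<ge> 0" using B[of 0] by auto
    have C0: "C \<ge> 0" using B0 by (simp add: C_def)
    (* The second moment of the unnormalized kernel against sin^2 stays equal to 1/2,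
       so this bound suffices after division by n. *)
    have bound: "\<bar>F u - F 0\<bar> \<le> e/2 + C * (sin (pi * u))\<^sup>2" if u: "u \<in> ?I" for u
    proof (cases "\<bar>u\<bar> < d")
      case True
      then have "\<bar>F u - F 0\<bar> \<le> e/2" using d(3)[OF u] by simp
      also have "\<dots> \<le> e/2 + C * (sin (pi * u))\<^sup>2" using C0 by simp
      finally show ?thesis .
    next
      case False
      have "sin (pi * d) \<le> sin (pi * \<bar>u\<bar>)"
        using False u d by (intro sin_monotone_2pi_le) (auto simp: abs_le_iff field_simps intro: order.trans[of _ 0])
      also have "\<dots> = \<bar>sin (pi * u)\<bar>"
      proof -
        have "sin (pi * \<bar>u\<bar>) \<ge> 0"
          using u by (intro sin_ge_zero) (auto simp: abs_le_iff)
        then show ?thesis by (cases "u \<ge> 0") auto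
      qed
      finally have "(sin (pi * d))\<^sup>2 \<le> (sin (pi * u))\<^sup>2"
        using sd by (metis abs_le_square_iff abs_of_pos)
      then have "2 * B \<le> C * (sin (pi * u))\<^sup>2"
        using sd B0 by (simp add: C_def field_simps mult_left_mono)
      moreover have "\<bar>F u - F 0\<bar> \<le> 2 * B"
        using B[OF u] B[of 0] by auto
      ultimately show ?thesis using e by simp
    qed
    \<comment> \<open>The sine term integrates to \<open>C / 2\<close> for every n > 0; beyond
      \<open>n0\<close> this is below \<open>e/2 * real n\<close>.\<close>
    obtain n0 :: nat where n0: "real n0 > C / e" using reals_Archimedean2 by blast
    show "\<exists>no. \<forall>n\<ge>no. norm (S n / real n - F 0) < e"
    proof (intro exI allI impI)
      fix n assume n: "n \<ge> Suc n0"
      then have npos: "n > 0" by simp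
      have i1: "((\<lambda>u. (F u - F 0) * fejer_sum n u) has_integral (S n - F 0 * real n)) ?I"
        unfolding left_diff_distrib
        by (intro has_integral_diff S has_integral_mult_right has_integral_fejer_sum)
      have i2: "((\<lambda>u. e/2 * fejer_sum n u + C * (fejer_sum n u * (sin (pi * u))\<^sup>2)) has_integral
          (e/2 * real n + C * (1/2))) ?I"
        by (intro has_integral_add has_integral_mult_right has_integral_fejer_sum
            has_integral_fejer_sum_sin_squared npos)
      have *: "\<bar>(F u - F 0) * fejer_sum n u\<bar>
          \<le> e/2 * fejer_sum n u + C * (fejer_sum n u * (sin (pi * u))\<^sup>2)" if "u \<in> ?I" for u
      proof -
        have "\<bar>(F u - F 0) * fejer_sum n u\<bar> = \<bar>F u - F 0\<bar> * fejer_sum n u"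
          by (simp add: abs_mult fejer_sum_nonneg)
        also have "\<dots> \<le> (e/2 + C * (sin (pi * u))\<^sup>2) * fejer_sum n u"
          by (intro mult_right_mono bound that fejer_sum_nonneg)
        finally show ?thesis by (simp add: algebra_simps)
      qed
      have "\<bar>S n - F 0 * real n\<bar> \<le> e/2 * real n + C * (1/2)"
      proof (rule abs_leI)
        show "S n - F 0 * real n \<le> e/2 * real n + C * (1/2)"
          using * by (intro has_integral_le[OF i1 i2]) (auto simp: abs_le_iff)
        show "- (S n - F 0 * real n) \<le> e/2 * real n + C * (1/2)"
          using * by (intro has_integral_le[OF has_integral_neg[OF i1] i2]) (force simp: abs_le_iff)
      qed
      moreover have "C < e * real n"
      proof -
        have "C < e * real n0" using n0 e by (simp add: field_simps)
        also have "\<dots> \<le> e * real n" using n e by simp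
        finally show ?thesis .
      qed
      ultimately have "\<bar>S n - F 0 * real n\<bar> < e * real n" by simp
      then show "norm (S n / real n - F 0) < e"
        using npos by (simp add: field_simps)
    qed
  qed
  then show ?thesis by (simp add: S_def)
qed

section \<open>Symmetric limits, Cesaro means and Poisson summation\<close>

text \<open>Symmetric intervals eventually contain every finite set of integers, so unordered sums
  and uniform limits along finite sets pass to ordinary sequences.\<close>

lemma filterlim_symmetric_int_interval:
  "filterlim (\<lambda>n. {- int n..int n}) (finite_subsets_at_top UNIV) sequentially"
  unfolding filterlim_finite_subsets_at_top
proof (intro allI impI)
  fix X :: "int set" assume "finite X \<and> X \<subseteq> UNIV"
  then have b: "\<bar>x\<bar> \<le> Max (abs ` X)" if "x \<in> X" for x
    using that by (intro Max_ge) auto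
  show "\<forall>\<^sub>F n in sequentially. finite {- int n..int n} \<and> X \<subseteq> {- int n..int n} \<and> {- int n..int n} \<subseteq> UNIV"
    using eventually_ge_at_top[of "nat (Max (abs ` X))"]
    by eventually_elim (use b in \<open>force simp: abs_le_iff nat_le_iff\<close>)
qed

lemma has_sum_imp_symmetric_limit:
  fixes f :: "int \<Rightarrow> 'a :: {comm_monoid_add, topological_space}"
  assumes "(f has_sum S) UNIV"
  shows "(\<lambda>n. \<Sum>k = - int n..int n. f k) \<longlonglongrightarrow> S"
  using assms filterlim_symmetric_int_interval unfolding has_sum_def by (rule filterlim_compose)

text \<open>Fejer's theorem only controls Cesaro means; this identifies their limit with the sum
  when the Fourier series converges.\<close>

lemma cesaro_mean_tendsto:
  fixes s :: "nat \<Rightarrow> real"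
  assumes "s \<longlonglongrightarrow> L"
  shows "(\<lambda>n. (\<Sum>k<n. s k) / real n) \<longlonglongrightarrow> L"
proof (rule LIMSEQ_I)
  fix e :: real assume e: "e > 0"
  obtain N where N: "\<And>k. k \<ge> N \<Longrightarrow> \<bar>s k - L\<bar> < e/2"
    using LIMSEQ_D[OF assms, of "e/2"] e by auto
  define C where "C = (\<Sum>k<N. \<bar>s k - L\<bar>)"
  obtain n0 :: nat where n0: "real n0 > 2 * C / e" using reals_Archimedean2 by blast
  show "\<exists>no. \<forall>n\<ge>no. norm ((\<Sum>k<n. s k) / real n - L) < e"
  proof (intro exI allI impI)
    fix n assume n: "n \<ge> max (Suc n0) N"
    then have npos: "n > 0" by simp
    have "(\<Sum>k<n. s k) - L * real n = (\<Sum>k<n. s k - L)"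
      by (simp add: sum_subtractf)
    then have "\<bar>(\<Sum>k<n. s k) - L * real n\<bar> \<le> (\<Sum>k<n. \<bar>s k - L\<bar>)"
      by (simp add: sum_abs)
    also have "\<dots> = C + (\<Sum>k=N..<n. \<bar>s k - L\<bar>)"
      using n sum.atLeastLessThan_concat[of 0 N n "\<lambda>k. \<bar>s k - L\<bar>"]
      by (simp add: C_def atLeast0LessThan)
    also have "(\<Sum>k=N..<n. \<bar>s k - L\<bar>) \<le> (\<Sum>k=N..<n. e/2)"
      using N by (intro sum_mono) (auto intro: less_imp_le)
    also have "\<dots> \<le> e/2 * real n" using e by (simp add: mult_right_mono)
    also have "C < e/2 * real n"
    proof -
      have "C < e/2 * real n0" using n0 e by (simp add: field_simps)
      also have "\<dots> \<le> e/2 * real n" using n e by simp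
      finally show ?thesis .
    qed
    finally have "\<bar>(\<Sum>k<n. s k) - L * real n\<bar> < e * real n" by simp
    then show "norm ((\<Sum>k<n. s k) / real n - L) < e"
      using npos by (simp add: field_simps)
  qed
qed

text \<open>Half-integer endpoints make the interval a union of unit cells centred at the integers
  from -N to N; each induction step adds one cell at either end.\<close>

lemma integral_symmetric_int_split:
  fixes g :: "real \<Rightarrow> real"
  assumes cont: "continuous_on UNIV g"
  shows "integral {- (real N + 1/2)..real N + 1/2} g
    = (\<Sum>k = - int N..int N. integral {-1/2..1/2} (\<lambda>u. g (u + of_int k)))"
proof (induction N)
  case 0
  show ?case by simp
next
  case (Suc N)
  let ?a = "real N + 1/2"
  have int: "g integrable_on {a..b}" for a b
    by (intro integrable_continuous_real continuous_on_subset[OF cont]) auto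
  have piece: "integral {-1/2..1/2} (\<lambda>u. g (u + c)) = integral {c - 1/2..c + 1/2} g" for c
    using integral_shift[of "-1/2" c "1/2" g] continuous_on_subset[OF cont]
    by (simp add: o_def add.commute)
  have "integral {- (?a + 1)..?a + 1} g
      = integral {- (?a + 1)..- ?a} g + integral {- ?a..?a} g + integral {?a..?a + 1} g"
    using Henstock_Kurzweil_Integration.integral_combine[of "- (?a + 1)" "- ?a" "?a + 1" g]
      Henstock_Kurzweil_Integration.integral_combine[of "- ?a" "?a" "?a + 1" g] int by simp
  moreover have "integral {- (?a + 1)..- ?a} g = integral {-1/2..1/2} (\<lambda>u. g (u + of_int (- int (Suc N))))"
    unfolding piece by (intro arg_cong[where f = "\<lambda>S. integral S g"]) auto
  moreover have "integral {?a..?a + 1} g = integral {-1/2..1/2} (\<lambda>u. g (u + of_int (int (Suc N))))"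
    unfolding piece by (intro arg_cong[where f = "\<lambda>S. integral S g"]) auto
  moreover have "- (?a + 1) = - (real (Suc N) + 1/2)" "?a + 1 = real (Suc N) + 1/2" by simp_all
  ultimately show ?case
    using Suc.IH by (simp only: sum_symmetric_int_Suc)
qed

lemma tendsto_symmetric_integral:
  fixes g :: "real \<Rightarrow> real"
  assumes "integrable lborel g"
  shows "(\<lambda>N. integral {- (real N + 1/2)..real N + 1/2} g) \<longlonglongrightarrow> (LINT x|lborel. g x)"
proof -
  let ?A = "\<lambda>N :: nat. {- (real N + 1/2)..real N + 1/2}"
  have un: "(\<Union>N. ?A N) = UNIV"
  proof (intro set_eqI iffI UNIV_I)
    fix x :: real
    obtain N :: nat where "\<bar>x\<bar> < real N" using reals_Archimedean2 by blast
    then have "x \<in> ?A N" by auto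
    then show "x \<in> (\<Union>N. ?A N)" by blast
  qed
  have si: "set_integrable lborel S g" if "S \<in> sets lborel" for S
    by (rule set_integrable_subset[of lborel UNIV]) (use assms that in \<open>simp_all add: set_integrable_def\<close>)
  have "(\<lambda>N. LINT x:?A N|lborel. g x) \<longlonglongrightarrow> (LINT x:(\<Union>N. ?A N)|lborel. g x)"
  proof (rule set_integral_cont_up)
    show "incseq ?A" by (auto simp: incseq_def)
    show "set_integrable lborel (\<Union>N. ?A N) g" unfolding un by (rule si) simp
  qed simp
  also have "(\<lambda>N. LINT x:?A N|lborel. g x) = (\<lambda>N. integral (?A N) g)"
    by (rule ext, rule set_borel_integral_eq_integral(2), rule si) simp
  finally show ?thesis unfolding un by (simp add: set_lebesgue_integral_def)
qed

text \<open>The cosine coefficients of the periodization \<open>F\<close> over one period are the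
  integrals of \<open>f\<close> over the whole line. Fejer gives their Cesaro means the limit
  \<open>F 0\<close>, the sum of \<open>f\<close> over the integers, while summability of the
  coefficients gives the limit \<open>S\<close>.\<close>

lemma poisson_summation_cos:
  fixes f :: "real \<Rightarrow> real" and M :: "int \<Rightarrow> real"
  assumes cont: "continuous_on UNIV f"
    and int: "integrable lborel f"
    and bound: "\<And>k u. \<bar>u\<bar> \<le> 1/2 \<Longrightarrow> \<bar>f (u + of_int k)\<bar> \<le> M k"
    and M: "M summable_on UNIV"
    and coeffs: "((\<lambda>k. LINT u|lborel. f u * cos (2 * pi * of_int k * u)) has_sum S) UNIV"
  shows "((\<lambda>k. f (of_int k)) has_sum S) UNIV"
proof -
  let ?I = "{-1/2..1/2::real}"
  define F where "F u = (\<Sum>\<^sub>\<infinity>k\<in>UNIV. f (u + of_int k))" for u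
  define a where "a k = (LINT u|lborel. f u * cos (2 * pi * of_int k * u))" for k :: int
  have cont': "continuous_on A (\<lambda>u. f (u + of_int k))" for A k
    by (intro continuous_on_compose2[OF cont] continuous_intros) auto
  have bound': "norm (f (u + of_int k)) \<le> M k" if "u \<in> ?I" for u k
    unfolding real_norm_def by (rule bound) (use that in auto)
  have "uniform_limit ?I (\<lambda>X u. \<Sum>k\<in>X. f (u + of_int k)) F (finite_subsets_at_top UNIV)"
    unfolding F_def using bound' M by (rule Weierstrass_m_test_general)
  then have ul: "uniform_limit ?I (\<lambda>N u. \<Sum>k = - int N..int N. f (u + of_int k)) F sequentially"
    using filterlim_symmetric_int_interval by (rule filterlim_compose)
  have contF: "continuous_on ?I F"
    by (rule uniform_limit_theorem[OF _ ul]) (auto intro!: always_eventually continuous_intros cont')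
  have coeff: "integral ?I (\<lambda>u. F u * cos (2 * pi * of_int k * u)) = a k" for k :: int
  proof -
    let ?e = "\<lambda>u. cos (2 * pi * of_int k * u)"
    have per: "?e (u + of_int j) = ?e u" for u and j :: int
    proof -
      have "?e (u + of_int j) = cos (2 * pi * of_int k * u + 2 * pi * of_int (k * j))"
        by (simp add: algebra_simps)
      then show ?thesis by (simp only: cos_add cos_int_2pin sin_int_2pin)
    qed
    \<comment> \<open>Multiplication by the bounded cosine keeps the convergence uniform, so limit
      and integral may be exchanged. As the cosine has period 1, the integrals \<open>I N\<close>
      are integrals of \<open>f\<close> times that cosine over growing intervals.\<close>
    have "uniform_limit ?I (\<lambda>N u. (\<Sum>k = - int N..int N. f (u + of_int k)) * ?e u) (\<lambda>u. F u * ?e u) sequentially"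
      by (intro uniform_lim_mult ul uniform_limit_const compact_imp_bounded compact_continuous_image contF continuous_intros) auto
    then obtain I J where IJ: "\<And>N. ((\<lambda>u. (\<Sum>k = - int N..int N. f (u + of_int k)) * ?e u) has_integral I N) ?I"
      "((\<lambda>u. F u * ?e u) has_integral J) ?I" "I \<longlonglongrightarrow> J"
      by (rule uniform_limit_integral) (auto intro!: continuous_intros cont')
    have "I = (\<lambda>N. integral {- (real N + 1/2)..real N + 1/2} (\<lambda>u. f u * ?e u))"
    proof
      fix N
      have "((\<lambda>u. \<Sum>j = - int N..int N. f (u + of_int j) * ?e u) has_integral
          (\<Sum>j = - int N..int N. integral ?I (\<lambda>u. f (u + of_int j) * ?e u))) ?I"
        by (intro has_integral_sum integrable_integral integrable_continuous_real continuous_intros cont') auto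
      then have "I N = (\<Sum>j = - int N..int N. integral ?I (\<lambda>u. f (u + of_int j) * ?e u))"
        using IJ(1)[of N] by (simp add: sum_distrib_right has_integral_unique)
      also have "\<dots> = integral {- (real N + 1/2)..real N + 1/2} (\<lambda>u. f u * ?e u)"
        by (subst integral_symmetric_int_split) (auto intro!: continuous_intros cont simp: per)
      finally show "I N = integral {- (real N + 1/2)..real N + 1/2} (\<lambda>u. f u * ?e u)" .
    qed
    moreover have "integrable lborel (\<lambda>u. f u * ?e u)"
      by (rule Bochner_Integration.integrable_bound[OF int])
        (auto intro!: borel_measurable_times borel_measurable_continuous_onI cont continuous_intros AE_I2
          simp: abs_mult mult_left_le)
    ultimately have "I \<longlonglongrightarrow> a k"
      unfolding a_def by (simp only: tendsto_symmetric_integral)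
    with IJ(3) have "J = a k" by (rule LIMSEQ_unique)
    with IJ(2) show ?thesis by (simp add: integral_unique)
  qed
  have "(\<lambda>n. (\<Sum>N<n. \<Sum>k = - int N..int N. a k) / real n) \<longlonglongrightarrow> F 0"
    using fejer[OF contF] unfolding coeff .
  moreover have "(\<lambda>n. (\<Sum>N<n. \<Sum>k = - int N..int N. a k) / real n) \<longlonglongrightarrow> S"
    unfolding a_def by (rule cesaro_mean_tendsto[OF has_sum_imp_symmetric_limit[OF coeffs]])
  ultimately have "F 0 = S" by (rule LIMSEQ_unique)
  moreover have "(\<lambda>k. f (of_int k)) summable_on UNIV"
    by (rule abs_summable_summable, rule Infinite_Sum.abs_summable_on_comparison_test'[OF M])
      (use bound[of 0] in simp)
  ultimately show ?thesis by (simp add: F_def has_sum_iff)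
qed

section \<open>Geometric tails and Gaussian decay\<close>

text \<open>The tail to the right of \<open>a\<close> and the one to the left of \<open>b\<close>
  are each dominated by a geometric series of sum \<open>C / (1 - r)\<close>; the integers strictly
  between are left out.\<close>

lemma
  fixes f :: "int \<Rightarrow> real"
  assumes "b < a" and nonneg: "\<And>k. f k \<ge> 0" and r: "0 \<le> r" "r < 1"
    and right: "\<And>i. f (a + int i) \<le> C * r ^ i" and left: "\<And>i. f (b - int i) \<le> C * r ^ i"
  shows summable_on_int_geometric_tails: "f summable_on (- {b<..<a})"
    and infsum_int_geometric_tails_le: "infsum f (- {b<..<a}) \<le> 2 * C / (1 - r)"
proof -
  have half: "f summable_on range g \<and> infsum f (range g) \<le> C / (1 - r)"
    if g: "inj g" "\<And>i. f (g i) \<le> C * r ^ i" for g :: "nat \<Rightarrow> int"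
  proof -
    have geo: "((\<lambda>i. C * r ^ i) has_sum (C * (1 / (1 - r)))) UNIV"
      using r by (intro has_sum_cmult_right norm_summable_imp_has_sum)
        (simp_all add: norm_power summable_geometric geometric_sums)
    have s: "(f \<circ> g) summable_on UNIV"
      by (rule summable_on_comparison_test[of "\<lambda>i. C * r ^ i"])
        (use geo g(2) nonneg in \<open>auto simp: has_sum_iff\<close>)
    have "infsum (f \<circ> g) UNIV \<le> C * (1 / (1 - r))"
      by (rule has_sum_mono[OF has_sum_infsum[OF s] geo]) (use g(2) in simp)
    then show ?thesis
      using s g(1) by (simp add: summable_on_reindex infsum_reindex)
  qed
  have R: "range (\<lambda>i. a + int i) = {a..}"
  proof (intro set_eqI iffI)
    fix k assume "k \<in> {a..}"
    then show "k \<in> range (\<lambda>i. a + int i)" by (intro image_eqI[of _ _ "nat (k - a)"]) auto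
  qed auto
  have L: "range (\<lambda>i. b - int i) = {..b}"
  proof (intro set_eqI iffI)
    fix k assume "k \<in> {..b}"
    then show "k \<in> range (\<lambda>i. b - int i)" by (intro image_eqI[of _ _ "nat (b - k)"]) auto
  qed auto
  have 1: "f summable_on {a..} \<and> infsum f {a..} \<le> C / (1 - r)"
    using half[of "\<lambda>i. a + int i"] right by (auto simp: R inj_on_def)
  have 2: "f summable_on {..b} \<and> infsum f {..b} \<le> C / (1 - r)"
    using half[of "\<lambda>i. b - int i"] left by (auto simp: L inj_on_def)
  have eq: "- {b<..<a} = {..b} \<union> {a..}" using \<open>b < a\<close> by auto
  have disj: "{..b} \<inter> {a..} = {}" using \<open>b < a\<close> by auto
  show "f summable_on (- {b<..<a})"
    unfolding eq using 1 2 disj by (intro summable_on_Un_disjoint) auto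
  show "infsum f (- {b<..<a}) \<le> 2 * C / (1 - r)"
    unfolding eq using 1 2 disj by (subst infsum_Un_disjoint) auto
qed

lemma summable_on_exp_minus_abs_int: "(\<lambda>k::int. exp (c - \<bar>of_int k\<bar> :: real)) summable_on UNIV"
proof -
  have e: "exp (- real i) = exp (- 1) ^ i" for i
    by (simp add: exp_of_nat_mult[symmetric])
  \<comment> \<open>No integer lies strictly between -1 and 0, so the two tails cover all
    integers.\<close>
  have "(\<lambda>k::int. exp (- \<bar>of_int k\<bar> :: real)) summable_on (- {-1<..<0})"
    by (rule summable_on_int_geometric_tails[of _ _ _ "exp (-1)" 1])
      (auto simp: e[symmetric] abs_of_nonpos)
  moreover have "- {-1<..<0::int} = UNIV" by auto
  ultimately have "(\<lambda>k::int. exp c * exp (- \<bar>of_int k\<bar> :: real)) summable_on UNIV"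
    by (simp add: summable_on_cmult_right)
  then show ?thesis by (simp add: exp_add[symmetric])
qed

lemma psi_pos: "psi x > 0"
  by (simp add: psi_def)

lemma psi_hat_pos: "psi_hat t > 0"
  by (simp add: psi_hat_def)

lemma psi_hat_minus [simp]: "psi_hat (- t) = psi_hat t"
  by (simp add: psi_hat_def)

text \<open>Completing the square trades Gaussian for exponential decay, which is enough for all
  summability claims and survives shifts by the triangle inequality.\<close>

lemma gaussian_le_exp_abs: "exp (- x\<^sup>2 / 2) \<le> exp (1/2 - \<bar>x\<bar> :: real)"
proof -
  have "0 \<le> (\<bar>x\<bar> - 1)\<^sup>2" by simp
  then show ?thesis by (simp add: power2_diff)
qed

lemma psi_le_exp_abs: "psi x \<le> exp (1/2 - \<bar>x\<bar>)"
proof -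
  have "1 \<le> 2 * pi" using pi_gt3 by simp
  then have "psi x \<le> exp (- x\<^sup>2 / 2)"
    by (simp add: psi_def field_simps)
  then show ?thesis using gaussian_le_exp_abs by (rule order_trans)
qed

lemma psi_hat_le_exp_abs: "psi_hat t \<le> exp (1/2 - \<bar>t\<bar>)"
proof -
  have "1 * 1 \<le> pi * pi" using pi_gt3 by (intro mult_mono) auto
  then have "1 * t\<^sup>2 \<le> (4 * pi\<^sup>2) * t\<^sup>2" by (intro mult_right_mono) (auto simp: power2_eq_square)
  then have "psi_hat t \<le> exp (- t\<^sup>2 / 2)"
    by (simp add: psi_hat_def)
  then show ?thesis using gaussian_le_exp_abs by (rule order_trans)
qed

lemma integrable_psi: "integrable lborel psi"
  unfolding psi_eq_std_normal_density by (rule integrable_normal_density) simp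

lemma continuous_on_psi [continuous_intros]:
  "continuous_on S g \<Longrightarrow> continuous_on S (\<lambda>x. psi (g x))"
  unfolding psi_def by (intro continuous_intros) auto

lemma integrable_psi_reflect_cos:
  "integrable lborel (\<lambda>u. psi (y - u) * cos (c * u))"
proof (rule Bochner_Integration.integrable_bound)
  show "integrable lborel (\<lambda>u. psi (y - u))"
    using lborel_integrable_real_affine[OF integrable_psi, of "-1" y] by simp
  show "(\<lambda>u. psi (y - u) * cos (c * u)) \<in> borel_measurable lborel"
    using borel_measurable_continuous_onI[of "\<lambda>u. psi (y - u) * cos (c * u)"]
    by (simp add: continuous_intros)
qed (auto simp: abs_mult psi_pos less_imp_le mult_left_le)

text \<open>Substituting x = y - u, the integrand becomes the real part of e^(2 pi i t y) times the
  integrand of the Fourier transform at \<open>t\<close>.\<close>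

lemma integral_psi_reflect_cos:
  "(LINT u|lborel. psi (y - u) * cos (2 * pi * t * u)) = psi_hat t * cos (2 * pi * t * y)"
proof -
  let ?h = "\<lambda>x. complex_of_real (psi x) * cis (- 2 * pi * t * x)"
  have "integrable lborel (\<lambda>x. complex_of_real (psi x))"
    using integrable_psi by (rule integrable_of_real)
  then have int: "integrable lborel ?h"
    by (rule Bochner_Integration.integrable_bound)
      (auto simp: norm_mult psi_eq_std_normal_density cis_conv_exp intro!: borel_measurable_continuous_onI)
  have "(LINT u|lborel. psi (y - u) * cos (2 * pi * t * u))
      = (LINT x|lborel. psi x * cos (2 * pi * t * (y - x)))"
    using lborel_integral_real_affine[of "-1" "\<lambda>u. psi (y - u) * cos (2 * pi * t * u)" y] by simp
  also have "\<dots> = (LINT x|lborel. Re (cis (2 * pi * t * y) * ?h x))"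
    by (intro Bochner_Integration.integral_cong refl)
      (simp add: cis_mult algebra_simps cos_diff)
  also have "\<dots> = Re (LINT x|lborel. cis (2 * pi * t * y) * ?h x)"
    by (intro integral_Re integrable_mult_right int)
  also have "\<dots> = psi_hat t * cos (2 * pi * t * y)"
    by (simp only: integral_mult_right_zero fourier_transform_psi) simp
  finally show ?thesis .
qed

lemma summable_on_psi_shift: "(\<lambda>k::int. psi (y - of_int k)) summable_on UNIV"
proof (rule summable_on_comparison_test[OF summable_on_exp_minus_abs_int[of "1/2 + \<bar>y\<bar>"]])
  fix k :: int
  have "psi (y - of_int k) \<le> exp (1/2 - \<bar>y - of_int k\<bar>)" by (rule psi_le_exp_abs)
  also have "\<dots> \<le> exp (1/2 + \<bar>y\<bar> - \<bar>of_int k\<bar>)" by simp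
  finally show "psi (y - of_int k) \<le> exp (1/2 + \<bar>y\<bar> - \<bar>of_int k\<bar>)" .
qed (simp add: psi_pos less_imp_le)

lemma summable_on_psi_hat_shift: "(\<lambda>k::int. psi_hat (s + of_int k)) summable_on UNIV"
proof (rule summable_on_comparison_test[OF summable_on_exp_minus_abs_int[of "1/2 + \<bar>s\<bar>"]])
  fix k :: int
  have "psi_hat (s + of_int k) \<le> exp (1/2 - \<bar>s + of_int k\<bar>)" by (rule psi_hat_le_exp_abs)
  also have "\<dots> \<le> exp (1/2 + \<bar>s\<bar> - \<bar>of_int k\<bar>)" by simp
  finally show "psi_hat (s + of_int k) \<le> exp (1/2 + \<bar>s\<bar> - \<bar>of_int k\<bar>)" .
qed (simp add: psi_hat_pos less_imp_le)

lemma summable_on_psi_hat_shift_cos: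
  "(\<lambda>k::int. psi_hat (s + of_int k) * cos (c k)) summable_on A"
proof -
  have "(\<lambda>k::int. psi_hat (s + of_int k) * cos (c k)) summable_on UNIV"
    by (rule abs_summable_summable, rule Infinite_Sum.abs_summable_on_comparison_test'[OF summable_on_psi_hat_shift[of s]])
      (simp add: abs_mult psi_hat_pos less_imp_le mult_left_le)
  then show ?thesis by (rule summable_on_subset_banach) auto
qed

section \<open>Poisson summation for the Gaussian and bounds on its lattice sums\<close>

text \<open>The product of the cosines of frequencies \<open>s\<close> and k is the mean of those of
  frequencies \<open>s + k\<close> and \<open>s - k\<close>, so the k-th coefficient is the mean of
  \<open>?d k\<close> and \<open>?d (- k)\<close>. Reflecting k shows that both halves have the same
  sum.\<close>

lemma poisson_summation_gaussian:
  "((\<lambda>j::int. psi (y - of_int j) * cos (2 * pi * s * of_int j)) has_sum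
    (\<Sum>\<^sub>\<infinity>k\<in>UNIV. psi_hat (s + of_int k) * cos (2 * pi * (s + of_int k) * y))) UNIV"
proof (rule poisson_summation_cos)
  let ?f = "\<lambda>u. psi (y - u) * cos (2 * pi * s * u)"
  let ?d = "\<lambda>k::int. psi_hat (s + of_int k) * cos (2 * pi * (s + of_int k) * y)"
  show "continuous_on UNIV ?f" by (intro continuous_intros)
  show "integrable lborel ?f" by (rule integrable_psi_reflect_cos)
  \<comment> \<open>The constant 1 is 1/2 from the decay estimate for \<open>psi\<close> plus the
    bound 1/2 on \<bar>u\<bar>.\<close>
  show "\<bar>?f (u + of_int k)\<bar> \<le> exp (1 + \<bar>y\<bar> - \<bar>of_int k\<bar>)" if "\<bar>u\<bar> \<le> 1/2" for k :: int and u
  proof -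
    have "\<bar>?f (u + of_int k)\<bar> \<le> psi (y - (u + of_int k))"
      by (simp add: abs_mult psi_pos less_imp_le mult_left_le)
    also have "\<dots> \<le> exp (1/2 - \<bar>y - (u + of_int k)\<bar>)" by (rule psi_le_exp_abs)
    also have "\<dots> \<le> exp (1 + \<bar>y\<bar> - \<bar>of_int k\<bar>)" using that by simp
    finally show ?thesis .
  qed
  show "(\<lambda>k::int. exp (1 + \<bar>y\<bar> - \<bar>of_int k\<bar>)) summable_on UNIV"
    by (rule summable_on_exp_minus_abs_int)
  have coeff: "(LINT u|lborel. ?f u * cos (2 * pi * of_int k * u)) = 1/2 * (?d k + ?d (- k))" for k :: int
  proof -
    have "?f u * cos (2 * pi * of_int k * u) =
       1/2 * (psi (y - u) * cos (2 * pi * (s + of_int k) * u) + psi (y - u) * cos (2 * pi * (s + of_int (- k)) * u))" for u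
      by (simp add: algebra_simps cos_add cos_diff)
    then have "(LINT u|lborel. ?f u * cos (2 * pi * of_int k * u)) =
       (LINT u|lborel. 1/2 * (psi (y - u) * cos (2 * pi * (s + of_int k) * u)
          + psi (y - u) * cos (2 * pi * (s + of_int (- k)) * u)))"
      by (simp only:)
    also have "\<dots> = 1/2 * (?d k + ?d (- k))"
      by (simp only: integral_mult_right_zero Bochner_Integration.integral_add
          integrable_psi_reflect_cos integral_psi_reflect_cos)
    finally show ?thesis .
  qed
  have d: "(?d has_sum infsum ?d UNIV) UNIV"
    by (rule has_sum_infsum, rule summable_on_psi_hat_shift_cos)
  then have "((\<lambda>k. ?d (- k)) has_sum infsum ?d UNIV) UNIV"
    by (subst has_sum_reindex_bij_betw[of uminus UNIV UNIV ?d]) (auto intro: bij_uminus)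
  from has_sum_cmult_right[OF has_sum_add[OF d this], of "1/2"]
  show "((\<lambda>k. LINT u|lborel. ?f u * cos (2 * pi * of_int k * u)) has_sum infsum ?d UNIV) UNIV"
    unfolding coeff by simp
qed

text \<open>For N \<ge> 1, (N + i)^2 \<ge> N^2 + i, so each further unit costs a factor exp (-2
  pi^2) \<le> 1/3. The ratio 1/3 makes two tails sum to 2 / (1 - 1/3) = 3 times the first term,
  which is the 3 in \<open>const_A\<close> and \<open>const_eps\<close>.\<close>

lemma psi_hat_le_geometric:
  assumes "real N + real i \<le> \<bar>t\<bar>" "N \<ge> 1"
  shows "psi_hat t \<le> psi_hat (real N) * (1/3) ^ i"
proof -
  have "1 * 1 \<le> pi * pi" using pi_gt3 by (intro mult_mono) auto
  then have "3 \<le> 1 + 2 * pi\<^sup>2" by (simp add: power2_eq_square)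
  also have "\<dots> \<le> exp (2 * pi\<^sup>2)" by (rule exp_ge_add_one_self)
  finally have q: "exp (- (2 * pi\<^sup>2)) \<le> 1/3" by (simp add: exp_minus field_simps)
  have "(real N)\<^sup>2 + real i \<le> (real N + real i)\<^sup>2"
  proof -
    have "real i \<le> 2 * real N * real i" using \<open>N \<ge> 1\<close> by (simp add: mult_le_cancel_right1)
    moreover have "0 \<le> (real i)\<^sup>2" by simp
    ultimately show ?thesis unfolding power2_sum by linarith
  qed
  also have "\<dots> \<le> t\<^sup>2"
    using power_mono[OF assms(1), of 2] by simp
  finally have "psi_hat t \<le> exp (- (2 * pi\<^sup>2) * ((real N)\<^sup>2 + real i))"
    by (simp add: psi_hat_def)
  also have "\<dots> = psi_hat (real N) * exp (- (2 * pi\<^sup>2)) ^ i"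
    by (simp add: psi_hat_def distrib_left exp_add exp_diff exp_minus exp_of_nat_mult[symmetric] field_simps)
  also have "\<dots> \<le> psi_hat (real N) * (1/3) ^ i"
    using q by (intro mult_left_mono power_mono) (auto simp: psi_hat_pos less_imp_le)
  finally show ?thesis .
qed

lemma infsum_psi_hat_le: "(\<Sum>\<^sub>\<infinity>k\<in>UNIV. psi_hat (of_int k)) \<le> 1 + 3 * psi_hat 1"
proof -
  have "infsum (\<lambda>k. psi_hat (of_int k)) (- {-1<..<1}) \<le> 2 * psi_hat 1 / (1 - 1/3)"
  proof (rule infsum_int_geometric_tails_le)
    show "psi_hat (of_int (1 + int i)) \<le> psi_hat 1 * (1/3) ^ i" for i
      using psi_hat_le_geometric[of 1 i] by simp
    show "psi_hat (of_int (-1 - int i)) \<le> psi_hat 1 * (1/3) ^ i" for i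
      using psi_hat_le_geometric[of 1 i "of_int (-1 - int i)"] by simp
  qed (auto simp: psi_hat_pos less_imp_le)
  moreover have "{-1<..<1::int} = {0}" by auto
  moreover have "(\<Sum>\<^sub>\<infinity>k\<in>UNIV. psi_hat (of_int k)) = psi_hat 0 + infsum (\<lambda>k. psi_hat (of_int k)) (- {0})"
  proof -
    have "(\<lambda>k. psi_hat (of_int k)) summable_on A" for A :: "int set"
      using summable_on_psi_hat_shift[of 0] by (auto intro: summable_on_subset_banach)
    then show ?thesis
      using infsum_Un_disjoint[of "\<lambda>k. psi_hat (of_int k)" "{0}" "- {0}"] by simp
  qed
  ultimately show ?thesis by (simp add: psi_hat_def)
qed

lemma infsum_psi_hat_cos_le:
  "(\<Sum>\<^sub>\<infinity>k\<in>UNIV. psi_hat (of_int k) * cos (c k)) \<le> 1 + 3 * psi_hat 1"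
proof -
  have "(\<Sum>\<^sub>\<infinity>k\<in>UNIV. psi_hat (of_int k) * cos (c k)) \<le> (\<Sum>\<^sub>\<infinity>k\<in>UNIV. psi_hat (of_int k))"
    using summable_on_psi_hat_shift_cos[of 0 c UNIV] summable_on_psi_hat_shift[of 0]
    by (intro infsum_mono) (auto simp: psi_hat_pos less_imp_le mult_left_le)
  also have "\<dots> \<le> 1 + 3 * psi_hat 1" by (rule infsum_psi_hat_le)
  finally show ?thesis .
qed

text \<open>Poisson summation with \<open>s = 0\<close> turns this into a sum of
  \<open>psi_hat\<close> at the integers with phases, which are at most 1.\<close>

lemma infsum_psi_shift_le: "(\<Sum>\<^sub>\<infinity>j\<in>UNIV. psi (y - of_int j)) \<le> 1 + 3 * psi_hat 1"
  using infsumI[OF poisson_summation_gaussian[of y 0]]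
    infsum_psi_hat_cos_le[of "\<lambda>k. 2 * pi * of_int k * y"] by simp

text \<open>Poisson summation at \<open>y = 0\<close> is read backwards here: the sum equals that of
  \<open>psi (- j)\<close> weighted by cosines, and dropping the cosines bounds it uniformly in
  \<open>t\<close>.\<close>

lemma infsum_psi_hat_shift_le: "(\<Sum>\<^sub>\<infinity>k\<in>UNIV. psi_hat (t + of_int k)) \<le> 1 + 3 * psi_hat 1"
proof -
  have "(\<Sum>\<^sub>\<infinity>k\<in>UNIV. psi_hat (t + of_int k)) \<le> (\<Sum>\<^sub>\<infinity>j\<in>UNIV. psi (0 - of_int j))"
    using poisson_summation_gaussian[of 0 t] summable_on_psi_shift[of 0]
    by (intro has_sum_mono[OF _ has_sum_infsum]) (auto simp: psi_pos less_imp_le mult_left_le)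
  also have "\<dots> \<le> 1 + 3 * psi_hat 1" by (rule infsum_psi_shift_le)
  finally show ?thesis .
qed

lemma psi_hat_four_terms_le:
  "psi_hat t + psi_hat (1 - t) + psi_hat (1 + t) + psi_hat (2 - t) \<le> 1 + 3 * psi_hat 1"
proof -
  have "(\<Sum>k\<in>{-2, -1, 0, 1}. psi_hat (t + of_int k)) \<le> (\<Sum>\<^sub>\<infinity>k\<in>UNIV. psi_hat (t + of_int k))"
    by (intro finite_sum_le_infsum summable_on_psi_hat_shift) (auto simp: psi_hat_pos less_imp_le)
  also have "\<dots> \<le> 1 + 3 * psi_hat 1" by (rule infsum_psi_hat_shift_le)
  finally show ?thesis
    using psi_hat_minus[of "1 - t"] psi_hat_minus[of "2 - t"] by (simp add: add_ac)
qed

section \<open>Quasi-interpolation of cosine modes\<close>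

lemma abs_cos_mode_le_1: "\<bar>cos_mode k x\<bar> \<le> 1"
  by (simp add: cos_mode_def)

lemma quasi_interp_cos_mode:
  assumes "n > 0"
  shows "quasi_interp n (cos_mode a) x
    = (\<Sum>\<^sub>\<infinity>k\<in>UNIV. psi_hat (of_int a / real n + of_int k) * cos_mode (a + int n * k) x)"
proof -
  have "quasi_interp n (cos_mode a) x
      = (\<Sum>\<^sub>\<infinity>j\<in>UNIV. psi (real n * x - of_int j) * cos (2 * pi * (of_int a / real n) * of_int j))"
    unfolding quasi_interp_def cos_mode_def by (intro infsum_cong) (simp add: mult_ac)
  also have "\<dots> = (\<Sum>\<^sub>\<infinity>k\<in>UNIV. psi_hat (of_int a / real n + of_int k)
      * cos (2 * pi * (of_int a / real n + of_int k) * (real n * x)))"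
    by (rule infsumI[OF poisson_summation_gaussian])
  also have "\<dots> = (\<Sum>\<^sub>\<infinity>k\<in>UNIV. psi_hat (of_int a / real n + of_int k) * cos_mode (a + int n * k) x)"
  proof -
    have "2 * pi * (of_int a / real n + of_int k) * (real n * x) = 2 * pi * of_int (a + int n * k) * x" for k
      using assms by (simp add: field_simps)
    then show ?thesis by (simp only: cos_mode_def)
  qed
  finally show ?thesis .
qed

text \<open>Frequencies differing by \<open>n\<close> agree at the nodes k/n. This is why barred and
  unbarred coefficients of equal index enter the recursion through their sum.\<close>

lemma quasi_interp_cos_mode_alias:
  assumes "n > 0"
  shows "quasi_interp n (cos_mode (a - int n)) = quasi_interp n (cos_mode a)"
proof -
  have "cos_mode (a - int n) (of_int k / real n) = cos_mode a (of_int k / real n)" for k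
  proof -
    have "cos_mode (a - int n) (of_int k / real n)
        = cos (2 * pi * of_int a * (of_int k / real n) - 2 * pi * of_int k)"
      using assms by (simp add: cos_mode_def field_simps)
    then show ?thesis by (simp add: cos_mode_def cos_diff)
  qed
  then show ?thesis by (simp add: quasi_interp_def fun_eq_iff)
qed

text \<open>The four displayed terms are the shifts k = 0, -1, 1, -2. For t between 0 and 1 the
  others satisfy \<bar>t + k\<bar> \<ge> 2 + i, where i counts from k = 2 upwards or from k = -3
  downwards, so both tails start below \<open>psi_hat 2\<close>.\<close>

lemma quasi_interp_cos_mode_approx:
  fixes a :: int
  assumes "n > 0" and t: "t = of_int a / real n" "0 \<le> t" "t \<le> 1"
  shows "\<bar>quasi_interp n (cos_mode a) x
    - (psi_hat t * cos_mode a x + psi_hat (1 - t) * cos_mode (a - int n) x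
      + psi_hat (1 + t) * cos_mode (a + int n) x + psi_hat (2 - t) * cos_mode (a - 2 * int n) x)\<bar>
    \<le> const_eps"
proof -
  let ?f = "\<lambda>k. psi_hat (t + of_int k) * cos_mode (a + int n * k) x"
  let ?K = "{-3<..<2::int}"
  have K: "?K = {-2, -1, 0, 1}" by auto
  have sum: "?f summable_on A" for A
    unfolding cos_mode_def by (rule summable_on_psi_hat_shift_cos)
  have eq: "quasi_interp n (cos_mode a) x = infsum ?f UNIV"
    unfolding quasi_interp_cos_mode[OF \<open>n > 0\<close>] t(1) ..
  have split: "infsum ?f UNIV = infsum ?f ?K + infsum ?f (- ?K)"
    using infsum_Un_disjoint[of ?f ?K "- ?K"] sum by simp
  have main: "infsum ?f ?K = psi_hat t * cos_mode a x + psi_hat (1 - t) * cos_mode (a - int n) x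
      + psi_hat (1 + t) * cos_mode (a + int n) x + psi_hat (2 - t) * cos_mode (a - 2 * int n) x"
    using psi_hat_minus[of "1 - t"] psi_hat_minus[of "2 - t"] by (simp add: K add_ac mult_ac)
  have "\<bar>infsum ?f (- ?K)\<bar> \<le> const_eps"
  proof -
    let ?g = "\<lambda>k::int. psi_hat (t + of_int k)"
    have "infsum ?g (- ?K) \<le> 2 * psi_hat 2 / (1 - 1/3)"
    proof (rule infsum_int_geometric_tails_le)
      show "?g (2 + int i) \<le> psi_hat 2 * (1/3) ^ i" for i
        using psi_hat_le_geometric[of 2 i "t + of_int (2 + int i)"] t by simp
      show "?g (-3 - int i) \<le> psi_hat 2 * (1/3) ^ i" for i
        using psi_hat_le_geometric[of 2 i "t + of_int (-3 - int i)"] t by simp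
    qed (auto simp: psi_hat_pos less_imp_le)
    moreover have g: "?g summable_on (- ?K)"
      by (rule summable_on_subset_banach[OF summable_on_psi_hat_shift]) auto
    moreover have "norm (infsum ?f (- ?K)) \<le> infsum ?g (- ?K)"
      by (rule norm_infsum_le[OF has_sum_infsum[OF sum] has_sum_infsum[OF g]])
        (simp add: abs_mult psi_hat_pos less_imp_le mult_left_le abs_cos_mode_le_1)
    ultimately show ?thesis by (simp add: const_eps_def)
  qed
  then show ?thesis unfolding eq split main by simp
qed

section \<open>Boundedness and linearity of the operators\<close>

lemma summable_on_quasi_interp:
  assumes "\<And>x. \<bar>f x\<bar> \<le> B"
  shows "(\<lambda>k::int. f (of_int k / real n) * psi (real n * x - of_int k)) summable_on UNIV"
proof (rule abs_summable_summable, rule Infinite_Sum.abs_summable_on_comparison_test')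
  show "(\<lambda>k::int. B * psi (real n * x - of_int k)) summable_on UNIV"
    by (intro summable_on_cmult_right summable_on_psi_shift)
qed (simp add: abs_mult psi_pos less_imp_le assms mult_right_mono)

lemma abs_quasi_interp_le:
  assumes B: "\<And>x. \<bar>f x\<bar> \<le> B"
  shows "\<bar>quasi_interp n f x\<bar> \<le> B * (1 + 3 * psi_hat 1)"
proof -
  have "norm (quasi_interp n f x) \<le> (\<Sum>\<^sub>\<infinity>k\<in>UNIV. B * psi (real n * x - of_int k))"
    unfolding quasi_interp_def
    by (rule norm_infsum_le[OF has_sum_infsum[OF summable_on_quasi_interp[OF B]]
          has_sum_infsum[OF summable_on_cmult_right[OF summable_on_psi_shift]]])
      (simp add: abs_mult psi_pos less_imp_le B mult_right_mono)
  also have "\<dots> = B * (\<Sum>\<^sub>\<infinity>k\<in>UNIV. psi (real n * x - of_int k))"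
    by (rule infsum_cmult_right')
  also have "\<dots> \<le> B * (1 + 3 * psi_hat 1)"
    using B[of 0] by (intro mult_left_mono infsum_psi_shift_le) auto
  finally show ?thesis by simp
qed

text \<open>\<open>const_A\<close> is the bound \<open>1 + 3 * psi_hat 1\<close> for the interpolant
  plus 1 for the subtracted identity.\<close>

lemma abs_error_op_le:
  assumes "\<And>x. \<bar>f x\<bar> \<le> B"
  shows "\<bar>error_op n f x\<bar> \<le> B * const_A"
  using abs_quasi_interp_le[of f B n x, OF assms] assms[of x]
  by (simp add: error_op_def const_A_def algebra_simps)

lemma quasi_interp_add:
  assumes "\<And>x. \<bar>f x\<bar> \<le> B" "\<And>x. \<bar>g x\<bar> \<le> C"
  shows "quasi_interp n (\<lambda>x. f x + g x) x = quasi_interp n f x + quasi_interp n g x"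
  unfolding quasi_interp_def distrib_right
  by (rule infsum_add; rule summable_on_quasi_interp, rule assms)

lemma quasi_interp_cmult: "quasi_interp n (\<lambda>x. c * f x) x = c * quasi_interp n f x"
  unfolding quasi_interp_def mult.assoc by (rule infsum_cmult_right')

lemma quasi_interp_sum:
  assumes "finite I" "\<And>i x. i \<in> I \<Longrightarrow> \<bar>f i x\<bar> \<le> B i"
  shows "quasi_interp n (\<lambda>x. \<Sum>i\<in>I. f i x) x = (\<Sum>i\<in>I. quasi_interp n (f i) x)"
  using assms
proof (induction I rule: finite_induct)
  case empty
  show ?case by (simp add: quasi_interp_def)
next
  case (insert i I)
  have "\<bar>\<Sum>i\<in>I. f i x\<bar> \<le> (\<Sum>i\<in>I. B i)" for x
    using insert.prems by (intro order.trans[OF sum_abs] sum_mono) auto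
  then have "quasi_interp n (\<lambda>x. f i x + (\<Sum>i\<in>I. f i x)) x
      = quasi_interp n (f i) x + quasi_interp n (\<lambda>x. \<Sum>i\<in>I. f i x) x"
    using insert.prems by (intro quasi_interp_add[of _ "B i" _ "\<Sum>i\<in>I. B i"]) auto
  with insert show ?case by simp
qed


section \<open>Induction over the levels\<close>

lemma sum_lessThan_double:
  fixes h :: "nat \<Rightarrow> 'a :: comm_monoid_add"
  shows "(\<Sum>j<2 * n. h j) = (\<Sum>j<n. h j + h (n + j))"
proof -
  have "(\<Sum>j<2 * n. h j) = (\<Sum>j<n. h j) + (\<Sum>j=n..<2 * n. h j)"
    using sum.atLeastLessThan_concat[of 0 n "2 * n" h] by (simp add: atLeast0LessThan)
  also have "(\<Sum>j=n..<2 * n. h j) = (\<Sum>j<n. h (n + j))"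
    using sum.shift_bounds_nat_ivl[of h 0 n n] by (simp add: atLeast0LessThan mult_2 add.commute)
  finally show ?thesis by (simp add: sum.distrib)
qed

lemma abs_mult_add_le:
  fixes x y q :: real
  assumes "q \<ge> 0"
  shows "\<bar>(x + y) * q\<bar> \<le> (\<bar>x\<bar> + \<bar>y\<bar>) * q"
  using assms by (simp add: abs_mult mult_right_mono)

text \<open>The new remainder is E(T p) - T (p + 1) plus E applied to the old remainder, by
  linearity of E. The first part is a truncation error of at most eps times the l^1 norm of the
  coefficients; the second is the old bound times A.\<close>

lemma multilevel_error_decomposition:
  fixes l m :: nat and a b :: "nat \<Rightarrow> nat \<Rightarrow> real"
  defines "T \<equiv> \<lambda>p x. \<Sum>j<2 ^ p. b p j * cos_mode (int m - 2 ^ l * (2 ^ p - int j)) x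
      + a p j * cos_mode (int m + 2 ^ l * int j) x"
    and "t \<equiv> \<lambda>p j. real m / 2 ^ (l + p) + real j / 2 ^ p"
  assumes m: "m \<le> 2 ^ l" and base: "a 0 0 = 1" "b 0 0 = 0"
    and rec: "\<And>p j. j < 2 ^ p \<Longrightarrow> b (Suc p) j = (b p j + a p j) * psi_hat (2 - t p j)"
      "\<And>p j. j < 2 ^ p \<Longrightarrow> b (Suc p) (2 ^ p + j)
        = b p j * (psi_hat (1 - t p j) - 1) + a p j * psi_hat (1 - t p j)"
      "\<And>p j. j < 2 ^ p \<Longrightarrow> a (Suc p) j = a p j * (psi_hat (t p j) - 1) + b p j * psi_hat (t p j)"
      "\<And>p j. j < 2 ^ p \<Longrightarrow> a (Suc p) (2 ^ p + j) = (b p j + a p j) * psi_hat (1 + t p j)"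
  shows "\<bar>multilevel_error (2 ^ l) p (cos_mode (int m)) x - T p x\<bar> \<le> real p * const_A ^ (p - 1) * const_eps"
proof -
  define S where "S p = (\<Sum>j<2 ^ p. \<bar>b p j\<bar> + \<bar>a p j\<bar>)" for p
  have A: "const_A \<ge> 0" using psi_hat_pos[of 1] by (simp add: const_A_def)
  have S: "S p \<le> const_A ^ p" for p
  proof (induction p)
    case 0
    show ?case by (simp add: S_def base)
  next
    case (Suc p)
    have "S (Suc p) = (\<Sum>j<2 ^ p. (\<bar>b (Suc p) j\<bar> + \<bar>a (Suc p) j\<bar>)
        + (\<bar>b (Suc p) (2 ^ p + j)\<bar> + \<bar>a (Suc p) (2 ^ p + j)\<bar>))"
      unfolding S_def power_Suc by (rule sum_lessThan_double)
    \<comment> \<open>Each old pair feeds four new coefficients. Their four \<open>psi_hat\<close>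
      factors total at most \<open>1 + 3 * psi_hat 1\<close>, and the two entries with -1 contribute
      the old pair once more.\<close>
    also have "\<dots> \<le> (\<Sum>j<2 ^ p. (\<bar>b p j\<bar> + \<bar>a p j\<bar>) * const_A)"
    proof (rule sum_mono)
      fix j assume "j \<in> {..<2 ^ p :: nat}"
      then have j: "j < 2 ^ p" by simp
      let ?s = "\<bar>b p j\<bar> + \<bar>a p j\<bar>" and ?t = "t p j"
      have bound: "\<bar>(b p j + a p j) * psi_hat v\<bar> \<le> ?s * psi_hat v" for v
        by (intro abs_mult_add_le less_imp_le psi_hat_pos)
      have "\<bar>b (Suc p) j\<bar> \<le> ?s * psi_hat (2 - ?t)" "\<bar>a (Suc p) (2 ^ p + j)\<bar> \<le> ?s * psi_hat (1 + ?t)"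
        unfolding rec[OF j] by (rule bound)+
      moreover have "\<bar>b (Suc p) (2 ^ p + j)\<bar> \<le> ?s * psi_hat (1 - ?t) + \<bar>b p j\<bar>"
        using bound[of "1 - ?t"] unfolding rec[OF j] by (simp add: algebra_simps)
      moreover have "\<bar>a (Suc p) j\<bar> \<le> ?s * psi_hat ?t + \<bar>a p j\<bar>"
        using bound[of ?t] unfolding rec[OF j] by (simp add: algebra_simps)
      moreover have "?s * (psi_hat ?t + psi_hat (1 - ?t) + psi_hat (1 + ?t) + psi_hat (2 - ?t)) \<le> ?s * (1 + 3 * psi_hat 1)"
        by (intro mult_left_mono psi_hat_four_terms_le) auto
      ultimately show "\<bar>b (Suc p) j\<bar> + \<bar>a (Suc p) j\<bar> + (\<bar>b (Suc p) (2 ^ p + j)\<bar> + \<bar>a (Suc p) (2 ^ p + j)\<bar>)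
          \<le> ?s * const_A"
        by (simp add: const_A_def distrib_left)
    qed
    also have "\<dots> = S p * const_A" by (simp add: S_def sum_distrib_right)
    also have "\<dots> \<le> const_A ^ p * const_A" using Suc.IH A by (rule mult_right_mono)
    finally show ?case by (simp add: mult.commute)
  qed
  have T_term_bound: "\<bar>b p j * cos_mode u x + a p j * cos_mode v x\<bar> \<le> \<bar>b p j\<bar> + \<bar>a p j\<bar>" for p j u v x
    by (rule order.trans[OF abs_triangle_ineq], rule add_mono)
      (simp_all add: abs_mult abs_cos_mode_le_1 mult_left_le)
  have T_bound: "\<bar>T p x\<bar> \<le> S p" for p x
    unfolding T_def S_def by (intro order.trans[OF sum_abs] sum_mono T_term_bound)
  have step: "\<bar>error_op (2 ^ p * 2 ^ l) (T p) x - T (Suc p) x\<bar> \<le> const_A ^ p * const_eps" for p x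
  proof -
    \<comment> \<open>With \<open>n\<close> the grid size at this level, the unbarred mode is
      \<open>c j\<close>, the barred one is its alias \<open>c j - n\<close>, and \<open>r j\<close>
      truncates their common interpolant to four terms.\<close>
    define n :: nat where "n = 2 ^ p * 2 ^ l"
    define c where "c j = int m + 2 ^ l * int j" for j
    define r where "r j = psi_hat (t p j) * cos_mode (c j) x + psi_hat (1 - t p j) * cos_mode (c j - int n) x
        + psi_hat (1 + t p j) * cos_mode (c j + int n) x + psi_hat (2 - t p j) * cos_mode (c j - 2 * int n) x" for j
    have n: "n > 0" by (simp add: n_def)
    have T: "T p = (\<lambda>x. \<Sum>j<2 ^ p. b p j * cos_mode (c j - int n) x + a p j * cos_mode (c j) x)"
      unfolding T_def c_def n_def by (simp add: algebra_simps)
    have "quasi_interp n (T p) x = (\<Sum>j<2 ^ p. quasi_interp n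
        (\<lambda>x. b p j * cos_mode (c j - int n) x + a p j * cos_mode (c j) x) x)"
      unfolding T by (rule quasi_interp_sum[OF _ T_term_bound]) simp
    also have "\<dots> = (\<Sum>j<2 ^ p. (b p j + a p j) * quasi_interp n (cos_mode (c j)) x)"
    proof (rule sum.cong[OF refl])
      fix j
      have "quasi_interp n (\<lambda>x. b p j * cos_mode (c j - int n) x + a p j * cos_mode (c j) x) x
          = b p j * quasi_interp n (cos_mode (c j - int n)) x + a p j * quasi_interp n (cos_mode (c j)) x"
        by (subst quasi_interp_add[of _ "\<bar>b p j\<bar>" _ "\<bar>a p j\<bar>"])
          (simp_all add: quasi_interp_cmult abs_mult abs_cos_mode_le_1 mult_left_le)
      then show "quasi_interp n (\<lambda>x. b p j * cos_mode (c j - int n) x + a p j * cos_mode (c j) x) x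
          = (b p j + a p j) * quasi_interp n (cos_mode (c j)) x"
        by (simp add: quasi_interp_cos_mode_alias n distrib_right)
    qed
    finally have Q: "quasi_interp n (T p) x = (\<Sum>j<2 ^ p. (b p j + a p j) * quasi_interp n (cos_mode (c j)) x)" .
    \<comment> \<open>This is the recursion read mode by mode: \<open>r j\<close> supplies the
      factors at \<open>c j - 2n\<close>, \<open>c j - n\<close>, \<open>c j\<close> and
      \<open>c j + n\<close>, and the two entries -1 come from subtracting
      \<open>T p\<close>.\<close>
    have "T (Suc p) x = (\<Sum>j<2 ^ p. (b p j + a p j) * r j
        - (b p j * cos_mode (c j - int n) x + a p j * cos_mode (c j) x))"
    proof -
      have "T (Suc p) x = (\<Sum>j<2 ^ p.
          (b (Suc p) j * cos_mode (int m - 2 ^ l * (2 ^ Suc p - int j)) x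
            + a (Suc p) j * cos_mode (int m + 2 ^ l * int j) x)
          + (b (Suc p) (2 ^ p + j) * cos_mode (int m - 2 ^ l * (2 ^ Suc p - int (2 ^ p + j))) x
            + a (Suc p) (2 ^ p + j) * cos_mode (int m + 2 ^ l * int (2 ^ p + j)) x))"
        unfolding T_def power_Suc[of "2::nat"] by (rule sum_lessThan_double)
      also have "\<dots> = (\<Sum>j<2 ^ p. (b p j + a p j) * r j
        - (b p j * cos_mode (c j - int n) x + a p j * cos_mode (c j) x))"
      proof (rule sum.cong[OF refl])
        fix j assume "j \<in> {..<2 ^ p :: nat}"
        then have j: "j < 2 ^ p" by simp
        have modes: "int m - 2 ^ l * (2 ^ Suc p - int j) = c j - 2 * int n"
          "int m + 2 ^ l * int j = c j"
          "int m - 2 ^ l * (2 ^ Suc p - int (2 ^ p + j)) = c j - int n"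
          "int m + 2 ^ l * int (2 ^ p + j) = c j + int n"
          by (simp_all add: c_def n_def algebra_simps)
        show "(b (Suc p) j * cos_mode (int m - 2 ^ l * (2 ^ Suc p - int j)) x
            + a (Suc p) j * cos_mode (int m + 2 ^ l * int j) x)
          + (b (Suc p) (2 ^ p + j) * cos_mode (int m - 2 ^ l * (2 ^ Suc p - int (2 ^ p + j))) x
            + a (Suc p) (2 ^ p + j) * cos_mode (int m + 2 ^ l * int (2 ^ p + j)) x)
          = (b p j + a p j) * r j - (b p j * cos_mode (c j - int n) x + a p j * cos_mode (c j) x)"
          unfolding modes rec[OF j] r_def by (simp add: algebra_simps)
      qed
      finally show ?thesis .
    qed
    then have "error_op n (T p) x - T (Suc p) x
        = (\<Sum>j<2 ^ p. (b p j + a p j) * (quasi_interp n (cos_mode (c j)) x - r j))"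
      unfolding error_op_def Q fun_cong[OF T] by (simp add: sum_subtractf sum.distrib algebra_simps)
    also have "\<bar>\<dots>\<bar> \<le> (\<Sum>j<2 ^ p. (\<bar>b p j\<bar> + \<bar>a p j\<bar>) * const_eps)"
    proof (intro order.trans[OF sum_abs] sum_mono)
      fix j assume "j \<in> {..<2 ^ p :: nat}"
      then have j: "real j + 1 \<le> 2 ^ p"
        using of_nat_mono[of "Suc j" "2 ^ p", where 'a = real] by simp
      have teq: "t p j = of_int (c j) / real n"
        by (simp add: t_def c_def n_def power_add field_simps)
      \<comment> \<open>The four-term approximation requires a normalized frequency between 0 and 1:
        here m / 2^(l+p) \<le> 1 / 2^p and j + 1 \<le> 2^p.\<close>
      have "t p j \<le> 1"
      proof -
        have "real m \<le> 2 ^ l" using of_nat_mono[OF m, where 'a = real] by simp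
        then have "real m / 2 ^ (l + p) \<le> 1 / 2 ^ p" by (simp add: power_add field_simps)
        then have "t p j \<le> (real j + 1) / 2 ^ p" by (simp add: t_def add_divide_distrib)
        also have "\<dots> \<le> 1" using j by simp
        finally show ?thesis .
      qed
      moreover have "0 \<le> t p j" by (simp add: t_def)
      ultimately have "\<bar>quasi_interp n (cos_mode (c j)) x - r j\<bar> \<le> const_eps"
        unfolding r_def by (intro quasi_interp_cos_mode_approx n teq)
      then show "\<bar>(b p j + a p j) * (quasi_interp n (cos_mode (c j)) x - r j)\<bar> \<le> (\<bar>b p j\<bar> + \<bar>a p j\<bar>) * const_eps"
        unfolding abs_mult by (intro mult_mono abs_triangle_ineq) auto
    qed
    also have "\<dots> = S p * const_eps" by (simp add: S_def sum_distrib_right)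
    also have "\<dots> \<le> const_A ^ p * const_eps"
      using S by (intro mult_right_mono) (simp_all add: const_eps_def psi_hat_pos less_imp_le)
    finally show ?thesis unfolding n_def .
  qed
  show ?thesis
  proof (induction p arbitrary: x)
    case 0
    show ?case by (simp add: T_def base)
  next
    case (Suc p)
    let ?M = "multilevel_error (2 ^ l) p (cos_mode (int m))"
    let ?g = "\<lambda>x. ?M x - T p x"
    let ?n = "2 ^ p * 2 ^ l :: nat"
    have "quasi_interp ?n ?M x = quasi_interp ?n (\<lambda>x. T p x + ?g x) x" by simp
    also have "\<dots> = quasi_interp ?n (T p) x + quasi_interp ?n ?g x"
      by (rule quasi_interp_add[OF T_bound Suc.IH])
    finally have "multilevel_error (2 ^ l) (Suc p) (cos_mode (int m)) x - T (Suc p) x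
        = (error_op ?n (T p) x - T (Suc p) x) + error_op ?n ?g x"
      by (simp add: error_op_def)
    then have "\<bar>multilevel_error (2 ^ l) (Suc p) (cos_mode (int m)) x - T (Suc p) x\<bar>
        \<le> const_A ^ p * const_eps + (real p * const_A ^ (p - 1) * const_eps) * const_A"
      using step[of p x] abs_error_op_le[of ?g, OF Suc.IH, of ?n x] by linarith
    \<comment> \<open>At \<open>p = 0\<close> the exponent \<open>p - 1\<close> is truncated to 0,
      but the factor \<open>real p\<close> vanishes; hence the case split.\<close>
    also have "\<dots> = real (Suc p) * const_A ^ (Suc p - 1) * const_eps"
      by (cases p) (simp_all add: algebra_simps)
    finally show ?case .
  qed
qed

section \<open>Extension of the coefficients to level 0 and the final bound\<close>

theorem proposition1:
  fixes l m :: nat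
    and \<alpha> \<beta> :: "nat \<Rightarrow> nat \<Rightarrow> real"  \<comment> \<open>\<open>\<alpha> p j\<close> is $\alpha_j^{(p)}$ and \<open>\<beta> p j\<close> is $\overline\alpha_j^{(p)}$\<close>
  assumes "l \<ge> 2" and "m < 2 ^ (l - 1)"
    and "\<beta> 1 0 = psi_hat (real m / 2 ^ l - 2)"
    and "\<alpha> 1 0 = psi_hat (real m / 2 ^ l) - 1"
    and "\<beta> 1 1 = psi_hat (real m / 2 ^ l - 1)"
    and "\<alpha> 1 1 = psi_hat (real m / 2 ^ l + 1)"
    and "\<And>p j. p \<ge> 1 \<Longrightarrow> j < 2 ^ p \<Longrightarrow>
      \<beta> (p + 1) j = (\<beta> p j + \<alpha> p j) * psi_hat (2 - real m / 2 ^ (l + p) - real j / 2 ^ p)"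
    and "\<And>p j. p \<ge> 1 \<Longrightarrow> j < 2 ^ p \<Longrightarrow>
      \<beta> (p + 1) (2 ^ p + j) =
        \<beta> p j * (psi_hat (1 - real m / 2 ^ (l + p) - real j / 2 ^ p) - 1)
        + \<alpha> p j * psi_hat (1 - real m / 2 ^ (l + p) - real j / 2 ^ p)"
    and "\<And>p j. p \<ge> 1 \<Longrightarrow> j < 2 ^ p \<Longrightarrow>
      \<alpha> (p + 1) j =
        \<alpha> p j * (psi_hat (real m / 2 ^ (l + p) + real j / 2 ^ p) - 1)
        + \<beta> p j * psi_hat (real m / 2 ^ (l + p) + real j / 2 ^ p)"
    and "\<And>p j. p \<ge> 1 \<Longrightarrow> j < 2 ^ p \<Longrightarrow>
      \<alpha> (p + 1) (2 ^ p + j) = (\<beta> p j + \<alpha> p j) * psi_hat (1 + real m / 2 ^ (l + p) + real j / 2 ^ p)"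
  shows "\<exists>g :: nat \<Rightarrow> real \<Rightarrow> real. \<forall>p \<ge> 1.
    (\<forall>x. multilevel_error (2 ^ l) p (cos_mode (int m)) x =
       (\<Sum>j = 0..2 ^ p - 1.
          \<beta> p j * cos_mode (int m - 2 ^ l * (2 ^ p - int j)) x
          + \<alpha> p j * cos_mode (int m + 2 ^ l * int j) x)
       + g p x)
    \<and> sup_norm (g p) \<le> ereal (real p * const_A ^ (p - 1) * const_eps)"
proof -
  \<comment> \<open>Level 0 is overwritten so that it represents \<open>cos_mode m\<close> itself,
    the zeroth multilevel error.\<close>
  define a where "a = \<alpha>(0 := \<lambda>_. 1)"
  define b where "b = \<beta>(0 := \<lambda>_. 0)"
  have ab: "a p = \<alpha> p" "b p = \<beta> p" if "p \<ge> 1" for p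
    using that by (simp_all add: a_def b_def)
  have ab0: "a 0 j = 1" "b 0 j = 0" for j
    by (simp_all add: a_def b_def)
  have even_psi_hat: "psi_hat (u - v) = psi_hat (v - u)" for u v
    using psi_hat_minus[of "u - v"] by simp
  have "m \<le> 2 ^ l"
    using assms(2) power_increasing[of "l - 1" l "2::nat"] by linarith
  let ?t = "\<lambda>p j. real m / 2 ^ (l + p) + real j / 2 ^ p"
  have rec: "b (Suc p) j = (b p j + a p j) * psi_hat (2 - ?t p j)
      \<and> b (Suc p) (2 ^ p + j) = b p j * (psi_hat (1 - ?t p j) - 1) + a p j * psi_hat (1 - ?t p j)
      \<and> a (Suc p) j = a p j * (psi_hat (?t p j) - 1) + b p j * psi_hat (?t p j)
      \<and> a (Suc p) (2 ^ p + j) = (b p j + a p j) * psi_hat (1 + ?t p j)"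
    if j: "j < 2 ^ p" for p j
  \<comment> \<open>At level 0 only j = 0 occurs, with frequency m / 2^l, and the recursion yields
    the prescribed level 1 values, up to the sign of two arguments of the even function
    \<open>psi_hat\<close>.\<close>
  proof (cases "p = 0")
    case True
    then show ?thesis
      using j assms(3-6) even_psi_hat[of 2 "real m / 2 ^ l"] even_psi_hat[of 1 "real m / 2 ^ l"] ab[of 1]
      by (simp add: ab0 add.commute)
  next
    case False
    then have p: "p \<ge> 1" by simp
    show ?thesis
      using assms(7-10)[OF p j] p by (simp add: ab diff_diff_eq add.assoc)
  qed
  note main = multilevel_error_decomposition[OF \<open>m \<le> 2 ^ l\<close> ab0 rec[THEN conjunct1]
      rec[THEN conjunct2, THEN conjunct1] rec[THEN conjunct2, THEN conjunct2, THEN conjunct1]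
      rec[THEN conjunct2, THEN conjunct2, THEN conjunct2]]
  let ?T = "\<lambda>p x. \<Sum>j = 0..2 ^ p - 1. \<beta> p j * cos_mode (int m - 2 ^ l * (2 ^ p - int j)) x
      + \<alpha> p j * cos_mode (int m + 2 ^ l * int j) x"
  define g where "g p x = multilevel_error (2 ^ l) p (cos_mode (int m)) x - ?T p x" for p x
  have "sup_norm (g p) \<le> ereal (real p * const_A ^ (p - 1) * const_eps)" if "p \<ge> 1" for p
  proof -
    have "{0..2 ^ p - 1} = {..<2 ^ p :: nat}"
      by (cases "2 ^ p :: nat") (auto simp: less_Suc_eq_le)
    then have "\<bar>g p x\<bar> \<le> real p * const_A ^ (p - 1) * const_eps" for x
      unfolding g_def using main[of p x] by (simp add: ab[OF that])
    then show ?thesis unfolding sup_norm_def by (intro SUP_least) simp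
  qed
  then show ?thesis by (intro exI[of _ g] allI impI conjI) (simp_all add: g_def)
qed

end
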